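(* There exists $\varepsilon>0$ such that for every $c\in(\tfrac32,\tfrac32+\varepsilon)$ the image $\Sigma_c\subset\mathbb{C}^2$ of the Levi-Civita embedding of the regularized rotating Kepler problem at energy $-c$, i.e. the compact connected component (diffeomorphic to $S^3$) of $$\Big\{(u,v)\in\mathbb{C}^2 : \tfrac12|u|^2+c|v|^2+2|v|^2\langle u,iv\rangle-\tfrac12=0\Big\}$$ lying over the bounded component of Hill's region, is not convex (that is, $\Sigma_c$ does not bound a convex domain in $\mathbb{C}^2\cong\mathbb{R}^4$).
   Context: Here $\langle\cdot,\cdot\rangle$ is the real inner product $\langle z,w\rangle=\operatorname{Re}(z\bar w)$ on $\mathbb{C}\cong\mathbb{R}^2$. The rotating Kepler problem has Hamiltonian $H(q,p)=\tfrac12|p|^2-\tfrac1{|q|}+(q_1p_2-q_2p_1)$ on $(\mathbb{R}^2\setminus\{0\})\times\mathbb{R}^2$, with unique critical value $-\tfrac32$. For $c>\tfrac32$ the Hill's region $\{q\neq0: -\tfrac1{|q|}-\tfrac12|q|^2\le -c\}$ (the projection of $H^{-1}(-c)$ to position space) has exactly one bounded component (contained in $\{|q|<1\}$) and one unbounded component. Writing $q,p$ as complex numbers, Levi-Civita coordinates $(u,v)\in\mathbb{C}^2$ are given by $q=2v^2$, $p=u/\bar v$; this is a 2:1 map, symplectic up to a constant factor. In these coordinates the regularized Hamiltonian at energy $-c$ is $$K_c(u,v)=|v|^2(H+c)=\tfrac12|u|^2+c|v|^2+2|v|^2\langle u,iv\rangle-\tfrac12,$$ and the bounded component of $H^{-1}(-c)$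 lifts to the compact component $\Sigma_c$ of $K_c^{-1}(0)$ (containing also the collision points $v=0$, $|u|=1$), i.e. the component contained in $\{|v|^2<\tfrac12\}$; it is diffeomorphic to $S^3$ and is the universal cover of the regularized energy hypersurface. *)

theory Defs
  imports "HOL-Analysis.Analysis"
begin

(* The plane R^2 is identified with the complex numbers throughout, so that
   "inner z w" is Re (z * cnj w) and q1 p2 - q2 p1 = Re q * Im p - Im q * Re p. *)

definition kepler_H :: "complex \<Rightarrow> complex \<Rightarrow> real" where
  "kepler_H q p = (norm p)\<^sup>2 / 2 - 1 / norm q + (Re q * Im p - Im q * Re p)"

definition hill_region :: "real \<Rightarrow> complex set" where
  "hill_region c = {q. q \<noteq> 0 \<and> - 1 / norm q - (norm q)\<^sup>2 / 2 \<le> - c}"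

(* For c > 3/2 there is exactly one bounded component: see ex1_bounded_hill_component. *)
definition bounded_hill_component :: "real \<Rightarrow> complex set" where
  "bounded_hill_component c = (THE B. B \<in> components (hill_region c) \<and> bounded B)"

definition levi_civita :: "complex \<times> complex \<Rightarrow> complex \<times> complex" where
  "levi_civita = (\<lambda>(u, v). (2 * v\<^sup>2, u / cnj v))"

definition kepler_K :: "real \<Rightarrow> complex \<Rightarrow> complex \<Rightarrow> real" where
  "kepler_K c u v = (norm u)\<^sup>2 / 2 + c * (norm v)\<^sup>2 + 2 * (norm v)\<^sup>2 * (u \<bullet> (\<i> * v)) - 1 / 2"

definition regularized_level :: "real \<Rightarrow> (complex \<times> complex) set" where
  "regularized_level c = {(u, v). kepler_K c u v = 0}"

(* The position of levi_civita (u, v) is 2 v^2, also at the collisions v = 0, which lie over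
   the origin; the origin is not in Hill's region and is therefore added by hand.
   For c > 3/2 the component is unique: see ex1_kepler_Sigma. *)
definition kepler_Sigma :: "real \<Rightarrow> (complex \<times> complex) set" where
  "kepler_Sigma c = (THE S. S \<in> components (regularized_level c) \<and> compact S \<and>
     (fst \<circ> levi_civita) ` S \<subseteq> insert 0 (bounded_hill_component c))"

(* A domain is a nonempty connected open set; convex sets are connected.  Boundedness of D is
   not required: for compact nonempty S in dimension at least 2 it is automatic. *)
definition bounds_convex_domain :: "'a::euclidean_space set \<Rightarrow> bool" where
  "bounds_convex_domain S \<longleftrightarrow> (\<exists>D. open D \<and> D \<noteq> {} \<and> convex D \<and> frontier D = S)"


lemma hill_region_eq_projection:
  "hill_region c = fst ` {(q, p). q \<noteq> 0 \<and> kepler_H q p = - c}"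
proof -
  have sq: "kepler_H q p = (norm (p + \<i> * q))\<^sup>2 / 2 - 1 / norm q - (norm q)\<^sup>2 / 2" for q p
    unfolding kepler_H_def cmod_power2 by (simp add: power2_eq_square algebra_simps) argo
  have "\<exists>p. kepler_H q p = - c" if le: "- 1 / norm q - (norm q)\<^sup>2 / 2 \<le> - c" for q
  proof
    define r where "r = 2 * (- c + 1 / norm q + (norm q)\<^sup>2 / 2)"
    have "r \<ge> 0" using le by (simp add: r_def)
    then show "kepler_H q (of_real (sqrt r) - \<i> * q) = - c"
      unfolding sq by (simp add: r_def add_divide_distrib diff_divide_distrib)
  qed
  moreover have "- 1 / norm q - (norm q)\<^sup>2 / 2 \<le> - c" if "kepler_H q p = - c" for q p
    using that zero_le_power2[of "norm (p + \<i> * q)"] unfolding sq minus_divide_left[symmetric]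
    by linarith
  ultimately show ?thesis
    unfolding hill_region_def image_def by fastforce
qed

lemma kepler_K_levi_civita:
  assumes "v \<noteq> 0" "levi_civita (u, v) = (q, p)"
  shows "kepler_K c u v = (norm v)\<^sup>2 * (kepler_H q p + c)"
proof -
  have q: "q = 2 * v\<^sup>2" and p: "p = u / cnj v" using assms by (auto simp: levi_civita_def)
  have "Re q * Im p - Im q * Re p = Im (cnj q * p)" by simp
  also have "cnj q * p = 2 * (cnj v * u)" using assms by (simp add: q p power2_eq_square)
  also have "Im \<dots> = 2 * (u \<bullet> (\<i> * v))" by (simp add: inner_complex_def algebra_simps)
  finally have ang: "Re q * Im p - Im q * Re p = 2 * (u \<bullet> (\<i> * v))" .
  have "norm q = 2 * (norm v)\<^sup>2" "norm p = norm u / norm v"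
    by (simp_all add: q p norm_mult norm_power norm_divide)
  moreover have "norm u = norm p * norm v" using assms calculation by simp
  ultimately show ?thesis
    using assms unfolding kepler_K_def kepler_H_def ang
    by (simp add: field_simps power2_eq_square)
qed

lemma hill_function_mono:
  fixes s t :: real
  assumes "1 \<le> s" "s \<le> t"
  shows "1 / s + s\<^sup>2 / 2 \<le> 1 / t + t\<^sup>2 / 2"
proof -
  have "1 * 1 \<le> s * t" using assms by (intro mult_mono) auto
  then have "1 / (s * t) \<le> 1" by simp
  also have "1 \<le> (s + t) / 2" using assms by (simp add: field_simps)
  finally have "0 \<le> (s + t) / 2 - 1 / (s * t)" by simp
  then have "0 \<le> (t - s) * ((s + t) / 2 - 1 / (s * t))"
    by (rule mult_nonneg_nonneg[rotated]) (use assms in linarith)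
  also have "\<dots> = 1 / t + t\<^sup>2 / 2 - (1 / s + s\<^sup>2 / 2)"
    using assms by (simp add: field_simps power2_eq_square)
  finally show ?thesis by simp
qed

lemma hill_function_antimono:
  fixes s t :: real
  assumes "0 < s" "s \<le> t" "t \<le> 1"
  shows "1 / t + t\<^sup>2 / 2 \<le> 1 / s + s\<^sup>2 / 2"
proof -
  have "s * t \<le> 1 * 1" using assms by (intro mult_mono) auto
  then have "1 \<le> 1 / (s * t)" using assms by simp
  moreover have "(s + t) / 2 \<le> 1" using assms by (simp add: field_simps)
  ultimately have "0 \<le> 1 / (s * t) - (s + t) / 2" by simp
  then have "0 \<le> (t - s) * (1 / (s * t) - (s + t) / 2)"
    by (rule mult_nonneg_nonneg[rotated]) (use assms in linarith)
  also have "\<dots> = 1 / s + s\<^sup>2 / 2 - (1 / t + t\<^sup>2 / 2)"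
    using assms by (simp add: field_simps power2_eq_square)
  finally show ?thesis by simp
qed

lemma hill_radius:
  assumes "c > 3 / 2"
  obtains b :: real where "0 < b" "b < 1"
    "\<And>r. 0 < r \<Longrightarrow> r \<le> 1 \<Longrightarrow> c \<le> 1 / r + r\<^sup>2 / 2 \<longleftrightarrow> r \<le> b"
proof -
  define g where "g r = r ^ 3 - 2 * c * r + 2" for r :: real
  have "\<exists>b\<ge>0. b \<le> 1 \<and> g b = 0"
    by (rule IVT2) (use assms in \<open>auto simp: g_def intro!: continuous_intros\<close>)
  then obtain b where b: "0 \<le> b" "b \<le> 1" "g b = 0" by auto
  have b0: "b \<noteq> 0" "b \<noteq> 1" using b assms by (auto simp: g_def)
  have g: "c \<le> 1 / r + r\<^sup>2 / 2 \<longleftrightarrow> g r \<ge> 0" if "0 < r" for r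
    using that by (simp add: g_def field_simps power2_eq_square power3_eq_cube)
  have "g r < 0" if "b < r" "r \<le> 1" for r
  proof -
    have "r * r \<le> 1 * 1" "r * b \<le> 1 * 1" "b * b \<le> 1 * 1"
      using that b by (intro mult_mono; simp)+
    then have "(r - b) * (r * r + r * b + b * b - 2 * c) < 0"
      using that assms by (intro mult_pos_neg) linarith+
    moreover have "g r - g b = (r - b) * (r * r + r * b + b * b - 2 * c)"
      by (simp add: g_def algebra_simps power3_eq_cube)
    ultimately show ?thesis using b by simp
  qed
  moreover have "c \<le> 1 / r + r\<^sup>2 / 2" if "0 < r" "r \<le> b" for r
    using hill_function_antimono[of r b] g[of b] that b by auto
  ultimately show ?thesis
    using b b0 g by (intro that[of b]) force+
qed

lemma connected_subset_below:
  fixes f :: "'a::topological_space \<Rightarrow> real"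
  assumes "connected T" "continuous_on T f" "x \<in> T" "f x < a" "\<And>y. y \<in> T \<Longrightarrow> f y \<noteq> a" "y \<in> T"
  shows "f y < a"
proof (rule ccontr)
  assume "\<not> f y < a"
  then have "a \<in> f ` T"
    using connectedD_interval[OF connected_continuous_image[OF assms(2,1)], of "f x" "f y" a] assms
    by auto
  with assms(5) show False by auto
qed

lemma ex1_bounded_hill_component:
  assumes "c > 3 / 2"
  shows "\<exists>!B. B \<in> components (hill_region c) \<and> bounded B"
    and "bounded_hill_component c = {q \<in> hill_region c. norm q < 1}"
proof -
  obtain b where b: "0 < b" "b < 1"
      "\<And>r. 0 < r \<Longrightarrow> r \<le> 1 \<Longrightarrow> c \<le> 1 / r + r\<^sup>2 / 2 \<longleftrightarrow> r \<le> b"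
    by (rule hill_radius[OF assms]) blast
  let ?P = "{q \<in> hill_region c. norm q < 1}"
  have mem: "q \<in> hill_region c \<longleftrightarrow> q \<noteq> 0 \<and> c \<le> 1 / norm q + (norm q)\<^sup>2 / 2" for q
    unfolding hill_region_def minus_divide_left[symmetric] by auto
  have not1: "norm q \<noteq> 1" if "q \<in> hill_region c" for q
    using that assms by (auto simp: mem)
  have P: "?P = cball 0 b - {0}"
    using b by (auto simp: mem)
  have conP: "connected ?P"
    unfolding P by (rule connected_punctured_convex) (use b in \<open>auto simp: aff_dim_cball\<close>)
  have "complex_of_real b \<in> ?P" unfolding P using b by auto
  then have neP: "?P \<noteq> {}" by blast
  have compP: "?P \<in> components (hill_region c)"
    unfolding in_components_maximal
  proof (intro conjI allI impI)
    fix T assume T: "T \<noteq> {} \<and> ?P \<subseteq> T \<and> T \<subseteq> hill_region c \<and> connected T"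
    have "norm y < 1" if "y \<in> T" for y
      by (rule connected_subset_below[of T norm "of_real b"])
         (use T that b(1,2) not1 \<open>complex_of_real b \<in> ?P\<close> in \<open>auto intro!: continuous_intros\<close>)
    then show "T = ?P" using T by blast
  qed (use conP neP in auto)
  moreover have "B = ?P" if B: "B \<in> components (hill_region c)" "bounded B" for B
  proof -
    obtain x where x: "x \<in> B" using in_components_nonempty[OF B(1)] by auto
    have xh: "x \<in> hill_region c" using x in_components_subset[OF B(1)] by auto
    show ?thesis
    proof (cases "norm x < 1")
      case True
      then have "x \<in> ?P" using xh by auto
      then show ?thesis using components_nonoverlap[OF B(1) compP] x by blast
    next
      case False
      define R where "R = (\<lambda>t. of_real t * x) ` {1..}"
      have "connected R" unfolding R_def
        by (intro connected_continuous_image continuous_intros convex_connected convex_real_interval)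
      moreover have "R \<subseteq> hill_region c"
      proof -
        have "of_real t * x \<in> hill_region c" if t: "1 \<le> t" for t
        proof -
          have "norm x \<le> norm (of_real t * x)"
            using mult_right_mono[OF t, of "norm x"] t by (simp add: norm_mult)
          then have "1 / norm x + (norm x)\<^sup>2 / 2
              \<le> 1 / norm (of_real t * x) + (norm (of_real t * x))\<^sup>2 / 2"
            by (rule hill_function_mono[rotated]) (use False in simp)
          then show ?thesis using xh t unfolding mem by auto
        qed
        then show ?thesis by (auto simp: R_def)
      qed
      moreover have "x \<in> R" unfolding R_def by (rule image_eqI[of _ _ 1]) auto
      ultimately have "R \<subseteq> B" using components_maximal[OF B(1)] x by blast
      then obtain M where M: "\<And>y. y \<in> R \<Longrightarrow> norm y \<le> M"
        using B(2) by (meson bounded_iff subsetD)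
      define t where "t = \<bar>M\<bar> + 1"
      have "t * 1 \<le> t * norm x" using False by (intro mult_left_mono) (auto simp: t_def)
      moreover have "norm (of_real t * x) \<le> M" unfolding R_def by (rule M[unfolded R_def], rule imageI) (simp add: t_def)
      ultimately show ?thesis by (simp add: norm_mult t_def)
    qed
  qed
  moreover have "bounded ?P" unfolding P by (simp add: bounded_diff)
  ultimately show ex: "\<exists>!B. B \<in> components (hill_region c) \<and> bounded B" by blast
  show "bounded_hill_component c = ?P"
    unfolding bounded_hill_component_def
    by (rule the1_equality[OF ex]) (use compP \<open>bounded ?P\<close> in blast)
qed

lemma kepler_K_complete_square:
  "2 * kepler_K c u v = (norm (u + 2 * of_real ((norm v)\<^sup>2) * (\<i> * v)))\<^sup>2
     - (1 - 2 * c * (norm v)\<^sup>2 + 4 * ((norm v)\<^sup>2) ^ 3)"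
proof -
  define s where "s = (norm v)\<^sup>2"
  have s: "(Re v)\<^sup>2 + (Im v)\<^sup>2 = s" by (simp add: s_def cmod_power2)
  have "(norm (u + 2 * of_real s * (\<i> * v)))\<^sup>2
      = (norm u)\<^sup>2 + 4 * s * (u \<bullet> (\<i> * v)) + 4 * s\<^sup>2 * ((Re v)\<^sup>2 + (Im v)\<^sup>2)"
    unfolding cmod_power2 inner_complex_def by (simp add: power2_eq_square algebra_simps)
  then show ?thesis
    unfolding s kepler_K_def s_def[symmetric]
    by (simp add: algebra_simps power2_eq_square power3_eq_cube)
qed

lemma ex1_kepler_Sigma:
  assumes "c > 3 / 2"
  shows "\<exists>!S. S \<in> components (regularized_level c) \<and> compact S \<and>
     (fst \<circ> levi_civita) ` S \<subseteq> insert 0 (bounded_hill_component c)"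
    and "kepler_Sigma c = {(u, v). kepler_K c u v = 0 \<and> (norm v)\<^sup>2 < 1 / 2}"
proof -
  obtain b where b: "0 < b" "b < 1"
      "\<And>r. 0 < r \<Longrightarrow> r \<le> 1 \<Longrightarrow> c \<le> 1 / r + r\<^sup>2 / 2 \<longleftrightarrow> r \<le> b"
    by (rule hill_radius[OF assms]) blast
  define f where "f s = 1 - 2 * c * s + 4 * s ^ 3" for s :: real
  define \<rho> where "\<rho> = sqrt (b / 2)"
  define Q where "Q = {(u, v). kepler_K c u v = 0 \<and> (norm v)\<^sup>2 < 1 / 2}"
  define F where "F = (\<lambda>(v, w). (of_real (sqrt (f ((norm v)\<^sup>2))) * w
      - 2 * of_real ((norm v)\<^sup>2) * (\<i> * v), v :: complex))"
  have K0: "kepler_K c u v = 0 \<longleftrightarrow>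
      (norm (u + 2 * of_real ((norm v)\<^sup>2) * (\<i> * v)))\<^sup>2 = f ((norm v)\<^sup>2)" for u v
    using kepler_K_complete_square[of c u v] by (auto simp: f_def)
  have fs: "0 \<le> f s \<longleftrightarrow> s \<le> b / 2" if "0 \<le> s" "s \<le> 1 / 2" for s
  proof (cases "s = 0")
    case False
    then have "c \<le> 1 / (2 * s) + (2 * s)\<^sup>2 / 2 \<longleftrightarrow> 0 \<le> f s"
      using that by (simp add: f_def field_simps power2_eq_square power3_eq_cube)
    then show ?thesis using b(3)[of "2 * s"] False that by auto
  qed (use b in \<open>auto simp: f_def\<close>)
  have vle: "(norm v)\<^sup>2 \<le> b / 2" if "kepler_K c u v = 0" "(norm v)\<^sup>2 \<le> 1 / 2" for u v
    using that fs[of "(norm v)\<^sup>2"] unfolding K0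
    by (metis zero_le_power2)
  have rho: "norm v \<le> \<rho> \<longleftrightarrow> (norm v)\<^sup>2 \<le> b / 2" for v :: complex
    unfolding \<rho>_def using real_sqrt_le_iff[of "(norm v)\<^sup>2" "b / 2"] by simp
  have Q: "Q = F ` (cball 0 \<rho> \<times> sphere 0 1)"
  proof (intro equalityI subsetI)
    fix x assume "x \<in> Q"
    then obtain u v where x: "x = (u, v)" and K: "kepler_K c u v = 0" and v: "(norm v)\<^sup>2 < 1 / 2"
      by (auto simp: Q_def)
    define z where "z = u + 2 * of_real ((norm v)\<^sup>2) * (\<i> * v)"
    have nz: "norm z = sqrt (f ((norm v)\<^sup>2))"
      using K unfolding K0 z_def by (metis norm_ge_zero real_sqrt_unique)
    obtain w where w: "norm w = 1" "z = of_real (norm z) * w"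
    proof (cases "z = 0")
      case True then show ?thesis using that[of 1] by simp
    next
      case False then show ?thesis using that[of "z / of_real (norm z)"] by (simp add: norm_divide)
    qed
    have "x = F (v, w)" using w(2) unfolding nz by (simp add: F_def x z_def algebra_simps)
    moreover have "v \<in> cball 0 \<rho>" using vle[OF K] v rho by simp
    ultimately show "x \<in> F ` (cball 0 \<rho> \<times> sphere 0 1)" using w by auto
  next
    fix x assume "x \<in> F ` (cball 0 \<rho> \<times> sphere 0 1)"
    then obtain v w where x: "x = F (v, w)" and v: "(norm v)\<^sup>2 \<le> b / 2" and w: "norm w = 1"
      using rho by auto
    have "f ((norm v)\<^sup>2) \<ge> 0" using fs[of "(norm v)\<^sup>2"] v b by auto
    then show "x \<in> Q" using v b w by (simp add: x F_def Q_def K0 norm_mult)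
  qed
  have contF: "continuous_on (cball 0 \<rho> \<times> sphere 0 1) F"
    unfolding F_def f_def case_prod_unfold by (intro continuous_intros)
  have conQ: "connected Q" unfolding Q
    by (intro connected_continuous_image contF connected_Times convex_connected connected_sphere)
       auto
  have compQ: "compact Q" unfolding Q
    by (intro compact_continuous_image contF compact_Times) auto
  have x0: "(1, 0) \<in> Q" by (simp add: Q_def kepler_K_def)
  have QL: "Q \<subseteq> regularized_level c" by (auto simp: Q_def regularized_level_def)
  have ne: "(norm v)\<^sup>2 \<noteq> 1 / 2" if "(u, v) \<in> regularized_level c" for u v
    using vle[of u v] that b by (auto simp: regularized_level_def)
  have compoQ: "Q \<in> components (regularized_level c)"
    unfolding in_components_maximal
  proof (intro conjI allI impI)
    fix T assume T: "T \<noteq> {} \<and> Q \<subseteq> T \<and> T \<subseteq> regularized_level c \<and> connected T"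
    have "(norm (snd y))\<^sup>2 < 1 / 2" if "y \<in> T" for y
      by (rule connected_subset_below[of T "\<lambda>y. (norm (snd y))\<^sup>2" "(1, 0)"])
         (use T that x0 in \<open>auto simp: Q_def intro!: continuous_intros dest: ne[OF subsetD]\<close>)
    then show "T = Q" using T by (force simp: Q_def regularized_level_def)
  qed (use conQ x0 QL in auto)
  have n2: "norm (2 * v\<^sup>2) = 2 * (norm v)\<^sup>2" for v :: complex
    by (simp add: norm_mult norm_power)
  have "2 * v\<^sup>2 \<in> insert 0 (bounded_hill_component c)" if "(u, v) \<in> Q" for u v
  proof (cases "v = 0")
    case False
    have K: "kepler_K c u v = 0" and v: "(norm v)\<^sup>2 < 1 / 2" using that by (auto simp: Q_def)
    have "c \<le> 1 / norm (2 * v\<^sup>2) + (norm (2 * v\<^sup>2))\<^sup>2 / 2"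
      unfolding n2 using vle[OF K] v False by (subst b(3)) auto
    then show ?thesis
      using v False n2[of v]
      unfolding ex1_bounded_hill_component(2)[OF assms] hill_region_def minus_divide_left[symmetric]
      by auto
  qed simp
  then have overQ: "(fst \<circ> levi_civita) ` Q \<subseteq> insert 0 (bounded_hill_component c)"
    by (auto simp: levi_civita_def simp del: insert_iff)
  have uniq: "S = Q" if S: "S \<in> components (regularized_level c)"
    "(fst \<circ> levi_civita) ` S \<subseteq> insert 0 (bounded_hill_component c)" for S
  proof -
    obtain u v where x: "(u, v) \<in> S" using in_components_nonempty[OF S(1)] by auto
    have "(u, v) \<in> regularized_level c" using x in_components_subset[OF S(1)] by auto
    moreover have "2 * v\<^sup>2 \<in> insert 0 (bounded_hill_component c)"
      using S(2) x by (force simp: levi_civita_def)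
    then have "2 * (norm v)\<^sup>2 < 1"
      unfolding ex1_bounded_hill_component(2)[OF assms] n2[symmetric] by auto
    ultimately have "(u, v) \<in> Q" by (auto simp: Q_def regularized_level_def)
    then show ?thesis using components_nonoverlap[OF S(1) compoQ] x by blast
  qed
  show ex: "\<exists>!S. S \<in> components (regularized_level c) \<and> compact S \<and>
     (fst \<circ> levi_civita) ` S \<subseteq> insert 0 (bounded_hill_component c)"
    using uniq compoQ compQ overQ by blast
  show "kepler_Sigma c = {(u, v). kepler_K c u v = 0 \<and> (norm v)\<^sup>2 < 1 / 2}"
    unfolding kepler_Sigma_def Q_def[symmetric]
    by (rule the1_equality[OF ex]) (use compoQ compQ overQ in blast)
qed

end

theory Submission
  imports Defs
begin

text \<open>
  The hypersurface is cut with the real plane of all points \<open>(\<i> b, r)\<close>, where \<open>b\<close> and \<open>r\<close> are real.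
  On this plane \<open>K\<^sub>c = 0\<close> is a quadratic equation for \<open>b\<close> (lemma \<open>kepler_K_slice\<close>), so the part of
  \<open>\<Sigma>\<^sub>c\<close> in the plane consists of the two graphs \<open>b = - 2 r\<^sup>3 \<plusminus> sqrt (1 - 2 c r\<^sup>2 + 4 r\<^sup>6)\<close>.  If
  \<open>\<Sigma>\<^sub>c\<close> bounded a convex domain, the lower graph would have to be a convex function of \<open>r\<close>.

  At the critical value \<open>c = 3/2\<close> the discriminant is \<open>(1 - 2 r\<^sup>2)\<^sup>2 (1 + r\<^sup>2)\<close>, and the lower graph is
  \<open>b = - 2 r\<^sup>3 - (1 - 2 r\<^sup>2) sqrt (1 + r\<^sup>2)\<close>.  At the critical point \<open>r = 1 / sqrt 2\<close> its second
  derivative is \<open>(10 / 3) sqrt 6 - 6 sqrt 2 < 0\<close>, so next to this point the lower graph is strictly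
  concave.  The values at \<open>r = 1/2, 3/5, 7/10\<close> already show this: the graph lies above its chord at
  the midpoint (lemma \<open>lower_branch_above_chord\<close>).  This is a strict inequality at parameters
  where the discriminant is positive, so it persists for all \<open>c\<close> close to \<open>3/2\<close>.

  The midpoint of the chord lies below both graphs.  It belongs to the closure of any convex domain
  bounded by \<open>\<Sigma>\<^sub>c\<close> but not to \<open>\<Sigma>\<^sub>c\<close>, hence to the domain itself; but then the vertical segment from it
  to the upper graph meets the boundary in its interior, at the lower graph, which is impossible in
  a convex domain (lemma \<open>convex_domain_frontier_segments\<close>).
\<close>

text \<open>
  A segment between two points of the closure stays in the closure; a segment from a point of the
  domain to a point of its closure can leave the domain only at its endpoint.  This turns
  non-convexity into a condition on finitely many points of \<open>S\<close>, and the domain need not be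
  identified.
\<close>

lemma convex_domain_frontier_segments:
  assumes "bounds_convex_domain S"
    and "a \<in> S" "b \<in> S" "y \<in> S"
    and "p \<in> closed_segment a b" "p \<notin> S" "q \<in> open_segment p y"
  shows "q \<notin> S"
proof -
  obtain D where D: "open D" "convex D" "frontier D = S"
    using assms(1) by (auto simp: bounds_convex_domain_def)
  have S: "S = closure D - D"
    using D by (simp add: frontier_def interior_open)
  have "closed_segment a b \<subseteq> closure D"
    using assms(2,3) S by (intro closed_segment_subset convex_closure D) auto
  then have "p \<in> interior D"
    using assms(5,6) S D(1) by (auto simp: interior_open)
  then have "open_segment p y \<subseteq> interior D"
    using assms(4) S by (intro in_interior_closure_convex_segment D) auto
  then show ?thesis
    using assms(7) S D(1) by (auto simp: interior_open)
qed

definition slice_disc :: "real \<Rightarrow> real \<Rightarrow> real" where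
  "slice_disc c r = 1 - 2 * c * r\<^sup>2 + 4 * r ^ 6"

definition lower_branch :: "real \<Rightarrow> real \<Rightarrow> real" where
  "lower_branch c r = - 2 * r ^ 3 - sqrt (slice_disc c r)"

definition upper_branch :: "real \<Rightarrow> real \<Rightarrow> real" where
  "upper_branch c r = - 2 * r ^ 3 + sqrt (slice_disc c r)"

definition slice_point :: "real \<Rightarrow> real \<Rightarrow> complex \<times> complex" where
  "slice_point b r = (\<i> * of_real b, of_real r)"

lemma kepler_K_slice:
  "2 * kepler_K c (\<i> * of_real b) (of_real r) = (b + 2 * r ^ 3)\<^sup>2 - slice_disc c r"
  unfolding kepler_K_def slice_disc_def
  by (simp add: norm_mult inner_complex_def power2_eq_square algebra_simps eval_nat_numeral)

lemma slice_point_in_kepler_Sigma_iff: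
  assumes "c > 3 / 2" "r\<^sup>2 < 1 / 2"
  shows "slice_point b r \<in> kepler_Sigma c \<longleftrightarrow> (b + 2 * r ^ 3)\<^sup>2 = slice_disc c r"
  using kepler_K_slice[of c b r] assms(2)
  by (auto simp: ex1_kepler_Sigma(2)[OF assms(1)] slice_point_def)

lemma branches_in_kepler_Sigma:
  assumes "c > 3 / 2" "r\<^sup>2 < 1 / 2" "slice_disc c r \<ge> 0"
  shows "slice_point (lower_branch c r) r \<in> kepler_Sigma c"
    and "slice_point (upper_branch c r) r \<in> kepler_Sigma c"
  using assms(3)
  by (simp_all add: slice_point_in_kepler_Sigma_iff[OF assms(1,2)]
      lower_branch_def upper_branch_def)

lemma below_lower_branch_notin_kepler_Sigma:
  assumes "c > 3 / 2" "r\<^sup>2 < 1 / 2" "slice_disc c r \<ge> 0" "b < lower_branch c r"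
  shows "slice_point b r \<notin> kepler_Sigma c"
proof -
  have "sqrt (slice_disc c r) < - (b + 2 * r ^ 3)"
    using assms(4) by (simp add: lower_branch_def)
  then have "(sqrt (slice_disc c r))\<^sup>2 < (- (b + 2 * r ^ 3))\<^sup>2"
    using assms(3) by (intro power_strict_mono) auto
  then have "slice_disc c r < (b + 2 * r ^ 3)\<^sup>2"
    using assms(3) by (simp only: real_sqrt_pow2 power2_minus)
  then show ?thesis
    by (simp add: slice_point_in_kepler_Sigma_iff[OF assms(1,2)])
qed

lemma midpoint_slice_point:
  "slice_point ((b + b') / 2) ((r + r') / 2) \<in> closed_segment (slice_point b r) (slice_point b' r')"
proof -
  have "slice_point ((b + b') / 2) ((r + r') / 2) = midpoint (slice_point b r) (slice_point b' r')"
    by (simp add: slice_point_def midpoint_def complex_eq_iff field_simps)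
  then show ?thesis by simp
qed

lemma vertical_open_segment:
  assumes "b < b'" "b' < b''"
  shows "slice_point b' r \<in> open_segment (slice_point b r) (slice_point b'' r)"
proof -
  define t where "t = (b' - b) / (b'' - b)"
  have t: "0 < t" "t < 1"
    using assms by (auto simp: t_def)
  have "t * (b'' - b) = b' - b"
    using assms by (simp add: t_def)
  then have b': "b' = (1 - t) * b + t * b''"
    by (simp add: algebra_simps)
  have "slice_point b' r = (1 - t) *\<^sub>R slice_point b r + t *\<^sub>R slice_point b'' r"
    unfolding b' by (simp add: slice_point_def complex_eq_iff algebra_simps)
  moreover have "slice_point b r \<noteq> slice_point b'' r"
    using assms by (simp add: slice_point_def)
  ultimately show ?thesis
    using t by (auto simp: in_segment)
qed

text \<open>
  If \<open>\<Sigma>\<^sub>c\<close> bounds a convex domain, the lower branch is midpoint convex: otherwise the midpoint of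
  the chord would lie below the branch, and the vertical segment from there to the upper branch
  would cross \<open>\<Sigma>\<^sub>c\<close>.
\<close>

lemma lower_branch_midpoint_convex:
  assumes c: "c > 3 / 2" and convex: "bounds_convex_domain (kepler_Sigma c)"
    and r: "r\<^sup>2 < 1 / 2" "slice_disc c r \<ge> 0"
    and r': "r'\<^sup>2 < 1 / 2" "slice_disc c r' \<ge> 0"
    and m: "m = (r + r') / 2" "m\<^sup>2 < 1 / 2" "slice_disc c m > 0"
  shows "lower_branch c m \<le> (lower_branch c r + lower_branch c r') / 2"
proof (rule ccontr)
  let ?b = "(lower_branch c r + lower_branch c r') / 2"
  assume "\<not> ?thesis"
  then have below: "?b < lower_branch c m" by simp
  have "slice_point (lower_branch c m) m \<notin> kepler_Sigma c"
  proof (rule convex_domain_frontier_segments[OF convex])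
    show "slice_point (lower_branch c r) r \<in> kepler_Sigma c"
      "slice_point (lower_branch c r') r' \<in> kepler_Sigma c"
      "slice_point (upper_branch c m) m \<in> kepler_Sigma c"
      using branches_in_kepler_Sigma[OF c] r r' m by auto
    show "slice_point ?b m
        \<in> closed_segment (slice_point (lower_branch c r) r) (slice_point (lower_branch c r') r')"
      unfolding m(1) by (rule midpoint_slice_point)
    show "slice_point ?b m \<notin> kepler_Sigma c"
      using c m(2) less_imp_le[OF m(3)] below by (rule below_lower_branch_notin_kepler_Sigma)
    show "slice_point (lower_branch c m) m
        \<in> open_segment (slice_point ?b m) (slice_point (upper_branch c m) m)"
      using below m(3)
      by (intro vertical_open_segment) (auto simp: lower_branch_def upper_branch_def)
  qed
  then show False
    using branches_in_kepler_Sigma(1)[OF c m(2) less_imp_le[OF m(3)]] by blast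
qed

lemma slice_disc_critical: "slice_disc (3 / 2) r = (1 - 2 * r\<^sup>2)\<^sup>2 * (1 + r\<^sup>2)"
  by (simp add: slice_disc_def algebra_simps eval_nat_numeral)

lemma lower_branch_critical:
  assumes "r\<^sup>2 \<le> 1 / 2"
  shows "lower_branch (3 / 2) r = - 2 * r ^ 3 - (1 - 2 * r\<^sup>2) * sqrt (1 + r\<^sup>2)"
  using assms by (simp add: lower_branch_def slice_disc_critical real_sqrt_mult)

text \<open>
  The second derivative of the lower branch at \<open>c = 3/2\<close> is negative from a little below \<open>r = 1/2\<close> up
  to the critical radius \<open>1 / sqrt 2\<close>, which is about \<open>0.707\<close>; the three radii are equidistant in
  this interval.  The curvature is small, and the branch exceeds the chord only by about \<open>0.001\<close>.
\<close>

lemma lower_branch_above_chord: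
  "(lower_branch (3 / 2) (1 / 2) + lower_branch (3 / 2) (7 / 10)) / 2 < lower_branch (3 / 2) (3 / 5)"
proof -
  have "1118 / 1000 < sqrt (5 / 4)" "122 / 100 < sqrt (149 / 100)"
    by (rule real_less_rsqrt, simp add: power2_eq_square)+
  moreover have "sqrt (34 / 25) < 1167 / 1000"
    by (rule real_less_lsqrt) (simp_all add: power2_eq_square)
  ultimately show ?thesis
    by (simp add: lower_branch_critical power2_eq_square power3_eq_cube)
qed

theorem theorem1p2:
  shows "\<exists>\<epsilon>>0. \<forall>c::real. 3 / 2 < c \<and> c < 3 / 2 + \<epsilon> \<longrightarrow> \<not> bounds_convex_domain (kepler_Sigma c)"
proof -
  define gap where
    "gap c = lower_branch c (3 / 5) - (lower_branch c (1 / 2) + lower_branch c (7 / 10)) / 2" for c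
  have lim: "(gap \<longlongrightarrow> gap (3 / 2)) (at_right (3 / 2))"
    "((\<lambda>c. slice_disc c r) \<longlongrightarrow> slice_disc (3 / 2) r) (at_right (3 / 2))" for r
    unfolding gap_def lower_branch_def slice_disc_def by (intro tendsto_intros; simp)+
  have disc: "\<forall>\<^sub>F c in at_right (3 / 2). slice_disc c r > 0" if "r\<^sup>2 < 1 / 2" for r
  proof -
    have "slice_disc (3 / 2) r > 0"
      unfolding slice_disc_critical using that by (intro mult_pos_pos) (auto simp: add_pos_nonneg)
    then show ?thesis
      by (rule order_tendstoD(1)[OF lim(2)])
  qed
  have "gap (3 / 2) > 0"
    using lower_branch_above_chord by (simp add: gap_def)
  then have "\<forall>\<^sub>F c in at_right (3 / 2). gap c > 0"
    by (rule order_tendstoD(1)[OF lim(1)])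
  moreover have radii: "(1 / 2 :: real)\<^sup>2 < 1 / 2" "(7 / 10 :: real)\<^sup>2 < 1 / 2" "(3 / 5 :: real)\<^sup>2 < 1 / 2"
    by (simp_all add: power2_eq_square)
  ultimately have "\<forall>\<^sub>F c in at_right (3 / 2). gap c > 0 \<and> slice_disc c (1 / 2) > 0
      \<and> slice_disc c (7 / 10) > 0 \<and> slice_disc c (3 / 5) > 0"
    using disc by (intro eventually_conj) auto
  then obtain d where d: "d > 3 / 2"
    "\<And>c. 3 / 2 < c \<Longrightarrow> c < d \<Longrightarrow> gap c > 0 \<and> slice_disc c (1 / 2) > 0
      \<and> slice_disc c (7 / 10) > 0 \<and> slice_disc c (3 / 5) > 0"
    unfolding eventually_at_right_field by blast
  have "\<not> bounds_convex_domain (kepler_Sigma c)" if c: "3 / 2 < c" "c < 3 / 2 + (d - 3 / 2)" for c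
  proof
    assume "bounds_convex_domain (kepler_Sigma c)"
    then have "gap c \<le> 0"
      using lower_branch_midpoint_convex[of c "1 / 2" "7 / 10" "3 / 5"] d(2)[of c] c radii
      by (simp add: gap_def)
    then show False
      using d(2)[of c] c by simp
  qed
  then show ?thesis
    using d(1) by (intro exI[of _ "d - 3 / 2"]) auto
qed

end
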